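(* Let $\mathcal{R}:=\mathcal{K}\cap[2/3,1]$, where $\mathcal{K}$ is the middle-third Cantor set, let $P(x,y):=xy$, let $\mathcal{L}$ be the Lebesgue measure on $\mathbb{R}$, and let $(\mathcal{D}_n)_{n\geq0}$ be the fast subdivision (defined in the context). For any $n\geq0$ we have $$ 0\leq\mathcal{L}\big(P(\mathcal{D}_n\times\mathcal{D}_n)\big)-\mathcal{L}\big(P(\mathcal{R}\times\mathcal{R})\big)\leq\frac{1}{63}\bigg(\frac{1}{36}\bigg)^n. $$
   Context: The middle-third Cantor set $\mathcal{K}\subset[0,1]$ is the set of points $\sum_{k\geq1}\alpha_k/3^k$ with $\alpha_k\in\{0,2\}$. For a closed interval $I=[a,b]$ with $a<b$, let $A_I:[0,1]\to I$, $A_I(x):=a+(b-a)x$. Let $\mathcal{B}\subset(0,1)$ be the disjoint union of open intervals $$ \mathcal{B}:=\Big(\bigcup_{k\geq1}\Big(\tfrac{1}{3^{k+1}},\tfrac{2}{3^{k+1}}\Big)\Big)\cup\Big(\tfrac13,\tfrac23\Big)\cup\Big(\bigcup_{k\geq1}\Big(\tfrac{3^{k+1}-2}{3^{k+1}},\tfrac{3^{k+1}-1}{3^{k+1}}\Big)\Big). $$ For a set $\mathcal{S}\subset[0,1]$ which is a union of countably many points and countably many intervals, let $\mathcal{E}(\mathcal{S})$ be the family of connected components of $\mathcal{S}$ with non-empty interior. The fast subdivision is defined by $\mathcal{D}_0:=[2/3,1]$ and, for $n\geq1$, $$ \mathcal{D}_n:=\mathcal{D}_{n-1}\setminus\bigcup_{I\in\mathcal{E}(\mathcal{D}_{n-1})}A_I(\mathcal{B}).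 $$ *)

theory Defs
  imports "HOL-Analysis.Analysis"
begin

definition cantor_set :: "real set" where
  "cantor_set = {x. \<exists>\<alpha>::nat \<Rightarrow> real. (\<forall>k\<ge>1. \<alpha> k \<in> {0, 2}) \<and> (\<lambda>k. \<alpha> (Suc k) / 3 ^ Suc k) sums x}"

definition right_cantor_set :: "real set" where
  "right_cantor_set = cantor_set \<inter> {2/3..1}"

definition prod_map :: "real \<times> real \<Rightarrow> real" where
  "prod_map = (\<lambda>(x, y). x * y)"

text \<open>The increasing affine map from \<open>[0,1]\<close> onto the closed interval \<open>I = [a,b]\<close>, \<open>a < b\<close>;
  the endpoints are recovered from the set as \<open>a = Inf I\<close> and \<open>b = Sup I\<close>.\<close>

definition interval_map :: "real set \<Rightarrow> real \<Rightarrow> real" where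
  "interval_map I x = Inf I + (Sup I - Inf I) * x"

definition gap_set :: "real set" where
  "gap_set =
     (\<Union>k\<in>{1::nat..}. {1 / 3 ^ (k + 1)<..<2 / 3 ^ (k + 1)})
     \<union> {1/3<..<2/3}
     \<union> (\<Union>k\<in>{1::nat..}. {(3 ^ (k + 1) - 2) / 3 ^ (k + 1)<..<(3 ^ (k + 1) - 1) / 3 ^ (k + 1)})"

definition fat_components :: "real set \<Rightarrow> real set set" where
  "fat_components S = {C \<in> components S. interior C \<noteq> {}}"

fun fast_subdivision :: "nat \<Rightarrow> real set" where
  "fast_subdivision 0 = {2/3..1}"
| "fast_subdivision (Suc n) =
     fast_subdivision n - (\<Union>I\<in>fat_components (fast_subdivision n). interval_map I ` gap_set)"

end

theory Submission
  imports Defs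
begin

text \<open>
  Let \<open>P\<close> be multiplication and call \<open>[a, a + t]\<close> a Cantor interval if the Cantor set meets it in a
  scaled copy of itself. If \<open>I\<close> and \<open>J\<close> are disjoint Cantor intervals of the same length in
  \<open>[2/3, 1]\<close>, then the four products of their outer thirds cover \<open>P(I \<times> J)\<close>, and iterating this,
  \<open>P(I \<times> J)\<close> lies in \<open>P(R \<times> R)\<close>. Two different points of \<open>D\<^sub>n\<close> that do not lie in the same
  component lie in opposite thirds of some Cantor interval, so \<open>P(D\<^sub>n \<times> D\<^sub>n)\<close> exceeds
  \<open>P(R \<times> R)\<close> only by what is lost inside the squares \<open>I \<times> I\<close> of components \<open>I\<close>. Passing from \<open>I\<close>
  of length \<open>t\<close> to its outer thirds loses one gap of length \<open>t\<^sup>2/9\<close>, so the total loss in \<open>I \<times> I\<close> is at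
  most \<open>t\<^sup>2/9 * (1 + 2/9 + (2/9)\<^sup>2 + \<dots>) = t\<^sup>2/7\<close>. One fast subdivision multiplies the sum of
  \<open>t\<^sup>2\<close> over the components by \<open>2 * (9\<^sup>-\<^sup>2 + 9\<^sup>-\<^sup>3 + \<dots>) = 1/36\<close>, and it is \<open>1/9\<close> initially.
\<close>

subsection \<open>The Cantor set and its scaled copies\<close>

lemma cantor_set_iff_digits:
  "x \<in> cantor_set \<longleftrightarrow> (\<exists>d. (\<forall>k. d k \<in> {0, 2}) \<and> (\<lambda>k. d k / 3 ^ Suc k) sums x)"
proof
  assume "x \<in> cantor_set"
  then obtain \<alpha> :: "nat \<Rightarrow> real" where "\<forall>k\<ge>1. \<alpha> k \<in> {0, 2}" "(\<lambda>k. \<alpha> (Suc k) / 3 ^ Suc k) sums x"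
    unfolding cantor_set_def by blast
  then show "\<exists>d. (\<forall>k. d k \<in> {0, 2}) \<and> (\<lambda>k. d k / 3 ^ Suc k) sums x"
    by (intro exI[of _ "\<lambda>k. \<alpha> (Suc k)"]) auto
next
  assume "\<exists>d. (\<forall>k. d k \<in> {0, 2}) \<and> (\<lambda>k. d k / 3 ^ Suc k) sums x"
  then obtain d where "\<forall>k. d k \<in> {0, 2}" "(\<lambda>k. d k / 3 ^ Suc k) sums x" by blast
  then show "x \<in> cantor_set"
    \<comment> \<open>At \<open>k = 0\<close> truncated subtraction yields \<open>d 0\<close>, a
      digit that the definition never reads.\<close>
    unfolding cantor_set_def mem_Collect_eq by (intro exI[of _ "\<lambda>k. d (k - 1)"]) auto
qed

lemma geometric_sums_third: "(\<lambda>k. 2 / 3 ^ Suc k) sums (1 :: real)"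
  using sums_mult[OF geometric_sums[of "1/3 :: real"], of "2/3"] by (simp add: power_divide)

lemma cantor_set_subset: "cantor_set \<subseteq> {0..1}"
proof
  fix x assume "x \<in> cantor_set"
  then obtain d where d: "\<forall>k. d k \<in> {0, 2}" and s: "(\<lambda>k. d k / 3 ^ Suc k) sums x"
    unfolding cantor_set_iff_digits by blast
  have b: "0 \<le> d k \<and> d k \<le> 2" for k using d[rule_format, of k] by auto
  have "0 \<le> x" by (rule sums_le[OF _ sums_zero s]) (use b in simp)
  moreover have "x \<le> 1"
    by (rule sums_le[OF _ s geometric_sums_third]) (use b in \<open>simp add: divide_right_mono\<close>)
  ultimately show "x \<in> {0..1}" by simp
qed

lemma cantor_set_step:
  assumes "x \<in> cantor_set"
  shows "\<exists>c\<in>{0, 2}. 3 * x - c \<in> cantor_set"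
proof -
  obtain d where d: "\<forall>k. d k \<in> {0, 2}" and s: "(\<lambda>k. d k / 3 ^ Suc k) sums x"
    using assms unfolding cantor_set_iff_digits by blast
  from s have "(\<lambda>k. d (Suc k) / 3 ^ Suc (Suc k)) sums (x - d 0 / 3)"
    by (subst sums_Suc_iff) simp
  from sums_mult[OF this, of 3] have "(\<lambda>k. d (Suc k) / 3 ^ Suc k) sums (3 * x - d 0)"
    by (simp add: algebra_simps)
  then have "3 * x - d 0 \<in> cantor_set"
    unfolding cantor_set_iff_digits using d by (intro exI[of _ "\<lambda>k. d (Suc k)"]) auto
  then show ?thesis using d by blast
qed

text \<open>The digits of \<open>x\<close> are the values \<open>c\<close> chosen along its orbit
  under \<open>3 * x - c\<close>. The orbit stays in \<open>{0..1}\<close>, so the remainder after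
  \<open>n\<close> digits is at most \<open>1 / 3 ^ n\<close> and vanishes. Membership proofs thus
  reduce to invariance under one expansion step.\<close>

lemma cantor_set_coinduct:
  assumes bnd: "S \<subseteq> {0..1}"
    and step: "\<And>x. x \<in> S \<Longrightarrow> \<exists>c\<in>{0, 2}. 3 * x - c \<in> S"
  shows "S \<subseteq> cantor_set"
proof
  fix x assume "x \<in> S"
  obtain c where c: "\<And>x. x \<in> S \<Longrightarrow> c x \<in> {0, 2} \<and> 3 * x - c x \<in> S"
    using step by metis
  define y where "y n = ((\<lambda>x. 3 * x - c x) ^^ n) x" for n
  have y: "y n \<in> S" for n
    by (induction n) (use \<open>x \<in> S\<close> c in \<open>auto simp: y_def\<close>)
  have part: "(\<Sum>k<n. c (y k) / 3 ^ Suc k) = x - y n / 3 ^ n" for n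
  proof (induction n)
    case (Suc n)
    have "y (Suc n) = 3 * y n - c (y n)" by (simp add: y_def)
    then show ?case using Suc by (simp add: field_simps)
  qed (simp add: y_def)
  have "(\<lambda>n. y n / 3 ^ n) \<longlonglongrightarrow> 0"
  proof (rule tendsto_sandwich[OF _ _ tendsto_const])
    show "(\<lambda>n. (1/3) ^ n) \<longlonglongrightarrow> (0::real)" by (rule LIMSEQ_power_zero) simp
    show "\<forall>\<^sub>F n in sequentially. 0 \<le> y n / 3 ^ n" using y bnd by (auto simp: subset_iff)
    show "\<forall>\<^sub>F n in sequentially. y n / 3 ^ n \<le> (1/3) ^ n"
      using y bnd by (auto simp: subset_iff power_divide divide_right_mono)
  qed
  from tendsto_diff[OF tendsto_const this, of x] have "(\<lambda>k. c (y k) / 3 ^ Suc k) sums x"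
    unfolding sums_def part by simp
  then show "x \<in> cantor_set"
    unfolding cantor_set_iff_digits using c y by (intro exI[of _ "\<lambda>k. c (y k)"]) auto
qed

lemma cantor_set_0 [simp]: "0 \<in> cantor_set"
  and cantor_set_1 [simp]: "1 \<in> cantor_set"
proof -
  have "{0, 1} \<subseteq> cantor_set" by (rule cantor_set_coinduct) auto
  then show "0 \<in> cantor_set" "1 \<in> cantor_set" by auto
qed

text \<open>Adjoining both points to the Cantor set keeps it invariant, since their first expansion
  step lands on \<open>u\<close>.\<close>

lemma cantor_set_third:
  assumes "u \<in> cantor_set"
  shows "u / 3 \<in> cantor_set" "(2 + u) / 3 \<in> cantor_set"
proof -
  have "cantor_set \<union> {u / 3, (2 + u) / 3} \<subseteq> cantor_set"
  proof (rule cantor_set_coinduct)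
    show "cantor_set \<union> {u / 3, (2 + u) / 3} \<subseteq> {0..1}"
      using assms cantor_set_subset by (auto simp: subset_iff)
    fix x assume "x \<in> cantor_set \<union> {u / 3, (2 + u) / 3}"
    then consider "x \<in> cantor_set" | "3 * x - 0 = u" | "3 * x - 2 = u"
      by (auto simp: field_simps)
    then show "\<exists>c\<in>{0, 2}. 3 * x - c \<in> cantor_set \<union> {u / 3, (2 + u) / 3}"
      using assms cantor_set_step[of x] by cases (blast, metis UnI1 insertCI, metis UnI1 insertCI)
  qed
  then show "u / 3 \<in> cantor_set" "(2 + u) / 3 \<in> cantor_set" by auto
qed

text \<open>Coinduction applies to the closure: the points that some digit sends into the closure
  form a union of two closed preimages, and this union contains the Cantor set, hence its
  closure.\<close>

lemma compact_cantor_set: "compact cantor_set"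
proof -
  have "closure cantor_set \<subseteq> cantor_set"
  proof (rule cantor_set_coinduct)
    show "closure cantor_set \<subseteq> {0..1}"
      using cantor_set_subset by (simp add: closure_minimal)
    have "cantor_set \<subseteq> (\<Union>c\<in>{0, 2}. (\<lambda>x. 3 * x - c) -` closure cantor_set)"
      using cantor_set_step closure_subset by fastforce
    moreover have "closed (\<Union>c\<in>{0, 2}. (\<lambda>x. 3 * x - c) -` closure cantor_set)"
      by (intro closed_UN ballI closed_vimage continuous_intros) auto
    ultimately have "closure cantor_set \<subseteq> (\<Union>c\<in>{0, 2}. (\<lambda>x. 3 * x - c) -` closure cantor_set)"
      by (rule closure_minimal)
    then show "\<exists>c\<in>{0, 2}. 3 * x - c \<in> closure cantor_set" if "x \<in> closure cantor_set" for x
      using that by auto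
  qed
  then have "closed cantor_set" using closure_subset_eq by auto
  then show ?thesis
    using cantor_set_subset bounded_closed_interval bounded_subset compact_eq_bounded_closed by blast
qed

definition cantor_copy :: "real \<Rightarrow> real \<Rightarrow> real set" where
  "cantor_copy a t = (\<lambda>u. a + t * u) ` cantor_set"

lemma compact_cantor_copy: "compact (cantor_copy a t)"
  unfolding cantor_copy_def
  by (intro compact_continuous_image compact_cantor_set continuous_intros)

lemma cantor_copy_ends: "a \<in> cantor_copy a t" "a + t \<in> cantor_copy a t"
proof -
  show "a \<in> cantor_copy a t"
    unfolding cantor_copy_def by (rule image_eqI[where x = 0]) auto
  show "a + t \<in> cantor_copy a t"
    unfolding cantor_copy_def by (rule image_eqI[where x = 1]) auto
qed

lemma cantor_copy_thirds:
  "cantor_copy a (t / 3) \<subseteq> cantor_copy a t" "cantor_copy (a + 2 * t / 3) (t / 3) \<subseteq> cantor_copy a t"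
proof -
  have "a + t / 3 * u = a + t * (u / 3)" "a + 2 * t / 3 + t / 3 * u = a + t * ((2 + u) / 3)" for u
    by (simp_all add: field_simps)
  then show "cantor_copy a (t / 3) \<subseteq> cantor_copy a t"
    "cantor_copy (a + 2 * t / 3) (t / 3) \<subseteq> cantor_copy a t"
    unfolding cantor_copy_def using cantor_set_third by (metis image_eqI image_subsetI)+
qed

subsection \<open>Products of separated copies\<close>

lemma prod_map_image: "prod_map ` (A \<times> B) = {x * y | x y. x \<in> A \<and> y \<in> B}"
  unfolding prod_map_def by force

lemma compact_prod_map: "compact A \<Longrightarrow> compact B \<Longrightarrow> compact (prod_map ` (A \<times> B))"
  unfolding prod_map_def case_prod_unfold
  by (intro compact_continuous_image compact_Times continuous_intros)

text \<open>Descending \<open>m\<close> times to a pair of outer thirds whose product still contains \<open>z\<close> leads to two left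
  endpoints, which belong to the copies.\<close>

lemma prod_map_separated_approx:
  assumes "2/3 \<le> a" "0 < t" "a + t \<le> b" "b + t \<le> 1" "a * b \<le> z" "z \<le> (a + t) * (b + t)"
  shows "\<exists>x\<in>cantor_copy a t. \<exists>y\<in>cantor_copy b t. \<bar>z - x * y\<bar> \<le> 3 * t / 3 ^ m"
  using assms
proof (induction m arbitrary: a b t)
  case 0
  \<comment> \<open>A crude width suffices: each of \<open>a\<close>, \<open>b\<close> and
    \<open>t\<close> is at most 1.\<close>
  have "(a + t) * (b + t) - a * b = t * (a + b + t)" by (simp add: algebra_simps)
  also have "\<dots> \<le> t * 3" using 0 by (intro mult_left_mono) auto
  finally have "\<bar>z - a * b\<bar> \<le> 3 * t / 3 ^ 0" using 0 by simp
  then show ?case using cantor_copy_ends by blast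
next
  case (Suc m)
  have sub: ?case if "a' \<in> {a, a + 2 * t / 3}" "b' \<in> {b, b + 2 * t / 3}"
    "a' * b' \<le> z" "z \<le> (a' + t / 3) * (b' + t / 3)" for a' b'
  proof -
    have "\<exists>x\<in>cantor_copy a' (t / 3). \<exists>y\<in>cantor_copy b' (t / 3). \<bar>z - x * y\<bar> \<le> 3 * (t / 3) / 3 ^ m"
      using that Suc.prems by (intro Suc.IH) auto
    then obtain x y where "x \<in> cantor_copy a' (t / 3)" "y \<in> cantor_copy b' (t / 3)"
      and "\<bar>z - x * y\<bar> \<le> 3 * t / 3 ^ Suc m" by auto
    moreover have "cantor_copy a' (t / 3) \<subseteq> cantor_copy a t" "cantor_copy b' (t / 3) \<subseteq> cantor_copy b t"
      using that(1,2) cantor_copy_thirds[of a t] cantor_copy_thirds[of b t] by blast+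
    ultimately show ?thesis by blast
  qed
  obtain s where t: "t = 3 * s" by (metis mult.commute nonzero_divide_eq_eq zero_neq_numeral)
  \<comment> \<open>These encode \<open>a \<le> b\<close>, \<open>a + s \<le> b\<close> and
    \<open>b \<le> 2 * a\<close>; the last holds because \<open>b \<le> 1\<close> and
    \<open>2/3 \<le> a\<close>. They make the product intervals of left-left, left-right, right-left
    and right-right thirds overlap consecutively.\<close>
  have "s * a \<le> s * b" "s * (a + s) \<le> s * b" "s * b \<le> s * (2 * a)" "0 < s * s"
    using Suc.prems by (simp_all add: t mult_left_mono)
  then have "a * (b + 2 * t / 3) \<le> (a + t / 3) * (b + t / 3)"
    "(a + 2 * t / 3) * b \<le> (a + t / 3) * (b + 2 * t / 3 + t / 3)"
    "(a + 2 * t / 3) * (b + 2 * t / 3) \<le> (a + 2 * t / 3 + t / 3) * (b + t / 3)"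
    by (simp_all add: t algebra_simps)
  then consider "z \<le> (a + t / 3) * (b + t / 3)"
    | "a * (b + 2 * t / 3) \<le> z" "z \<le> (a + t / 3) * (b + 2 * t / 3 + t / 3)"
    | "(a + 2 * t / 3) * b \<le> z" "z \<le> (a + 2 * t / 3 + t / 3) * (b + t / 3)"
    | "(a + 2 * t / 3) * (b + 2 * t / 3) \<le> z" by linarith
  then show ?case
  proof cases
    case 1 then show ?thesis using Suc.prems by (intro sub[of a b]) auto
  next
    case 2 then show ?thesis by (intro sub[of a "b + 2 * t / 3"]) auto
  next
    case 3 then show ?thesis by (intro sub[of "a + 2 * t / 3" b]) auto
  next
    case 4 then show ?thesis using Suc.prems by (intro sub[of "a + 2 * t / 3" "b + 2 * t / 3"]) (auto simp: add.commute)
  qed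
qed

text \<open>Products of points of the copies come arbitrarily close to every \<open>z\<close> in the
  interval, and the set of such products is compact, hence closed.\<close>

lemma prod_map_separated:
  assumes "2/3 \<le> a" "0 < t" "a + t \<le> b" "b + t \<le> 1"
  shows "{a * b..(a + t) * (b + t)} \<subseteq> prod_map ` (cantor_copy a t \<times> cantor_copy b t)"
proof
  fix z assume z: "z \<in> {a * b..(a + t) * (b + t)}"
  let ?P = "prod_map ` (cantor_copy a t \<times> cantor_copy b t)"
  have "z \<in> closure ?P"
    unfolding closure_approachable
  proof (intro allI impI)
    fix e :: real assume "0 < e"
    then have "0 < e / (3 * t)" using assms by simp
    then obtain m where "(1/3) ^ m < e / (3 * t)" using real_arch_pow_inv[of _ "1/3"] by auto
    then have m: "3 * t * (1/3) ^ m < e" using assms by (simp add: pos_less_divide_eq mult.commute)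
    obtain x y where "x \<in> cantor_copy a t" "y \<in> cantor_copy b t" "\<bar>z - x * y\<bar> \<le> 3 * t / 3 ^ m"
      using prod_map_separated_approx[OF assms, of z m] z by auto
    then show "\<exists>p\<in>?P. dist p z < e"
      unfolding prod_map_image using m
      by (intro bexI[of _ "x * y"]) (auto simp: dist_real_def power_divide)
  qed
  then show "z \<in> ?P"
    using compact_imp_closed[OF compact_prod_map[OF compact_cantor_copy compact_cantor_copy]]
    by (simp only: closure_closed)
qed

subsection \<open>Loss inside a single interval\<close>

text \<open>For \<open>0 \<le> a\<close> the interval from \<open>a\<^sup>2\<close> to
  \<open>(a + t)\<^sup>2\<close> consists of all products of two points of
  \<open>{a..a + t}\<close>, so the difference is what is lost by restricting both factors to the
  copy.\<close>

definition product_defect :: "real \<Rightarrow> real \<Rightarrow> real set" where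
  "product_defect a t = {a\<^sup>2..(a + t)\<^sup>2} - prod_map ` (cantor_copy a t \<times> cantor_copy a t)"

lemma product_defect_borel [measurable]: "product_defect a t \<in> sets lborel"
  unfolding product_defect_def
  by (intro sets.Diff) (auto intro!: borel_compact compact_prod_map compact_cantor_copy)

text \<open>The two outer thirds are separated, so their mixed products fill a whole interval. It
  starts no later than the span of the left-left products ends. A missed point therefore lies in the
  left-left span, in the right-right span, or between the mixed products and the right-right
  span.\<close>

lemma product_defect_split:
  assumes "2/3 \<le> a" "0 < t" "a + t \<le> 1"
  shows "product_defect a t \<subseteq> product_defect a (t / 3) \<union> product_defect (a + 2 * t / 3) (t / 3)
    \<union> {(a + t / 3) * (a + t)..(a + 2 * t / 3)\<^sup>2}"
proof
  fix z assume z: "z \<in> product_defect a t"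
  let ?P = "\<lambda>A B. prod_map ` (A \<times> B)"
  let ?L = "cantor_copy a (t / 3)" and ?R = "cantor_copy (a + 2 * t / 3) (t / 3)"
  have "?P ?L ?L \<union> ?P ?L ?R \<union> ?P ?R ?R \<subseteq> ?P (cantor_copy a t) (cantor_copy a t)"
    using cantor_copy_thirds[of a t] by (intro Un_least image_mono Sigma_mono) auto
  then have n: "z \<notin> ?P ?L ?L" "z \<notin> ?P ?L ?R" "z \<notin> ?P ?R ?R"
    using z by (auto simp: product_defect_def)
  have LR: "z \<notin> {a * (a + 2 * t / 3)..(a + t / 3) * (a + t)}"
    using prod_map_separated[of a "t / 3" "a + 2 * t / 3"] assms n(2) by (auto simp: add.commute)
  have ov: "a * (a + 2 * t / 3) \<le> (a + t / 3)\<^sup>2" by (simp add: power2_eq_square algebra_simps)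
  have zb: "a\<^sup>2 \<le> z" "z \<le> (a + t)\<^sup>2" using z by (auto simp: product_defect_def)
  then consider "z \<in> {a\<^sup>2..(a + t / 3)\<^sup>2}" | "z \<in> {(a + t / 3) * (a + t)..(a + 2 * t / 3)\<^sup>2}"
    | "z \<in> {(a + 2 * t / 3)\<^sup>2..(a + t)\<^sup>2}"
    using LR ov by (meson atLeastAtMost_iff linear order_trans)
  then show "z \<in> product_defect a (t / 3) \<union> product_defect (a + 2 * t / 3) (t / 3)
    \<union> {(a + t / 3) * (a + t)..(a + 2 * t / 3)\<^sup>2}"
    using n by cases (simp_all add: product_defect_def add.commute)
qed

text \<open>The constant 1/7 solves \<open>c = 2 * c / 9 + 1/9\<close>: two thirds of length
  \<open>t / 3\<close> and one gap of length \<open>t\<^sup>2 / 9\<close>. The error term starts as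
  the trivial length bound \<open>2 * t\<close> and shrinks by 2/3 at each splitting.\<close>

lemma emeasure_product_defect_approx:
  assumes "2/3 \<le> a" "0 < t" "a + t \<le> 1"
  shows "emeasure lborel (product_defect a t) \<le> ennreal (t\<^sup>2 / 7 + 2 * t * (2/3) ^ N)"
  using assms
proof (induction N arbitrary: a t)
  case 0
  have "(a + t)\<^sup>2 - a\<^sup>2 = (a + (a + t)) * t" by (simp add: power2_eq_square algebra_simps)
  also have "\<dots> \<le> 2 * t" using 0 by (intro mult_right_mono) auto
  also have "\<dots> \<le> t\<^sup>2 / 7 + 2 * t" by simp
  finally have "(a + t)\<^sup>2 - a\<^sup>2 \<le> t\<^sup>2 / 7 + 2 * t * (2/3) ^ 0" by simp
  moreover have "emeasure lborel (product_defect a t) \<le> emeasure lborel {a\<^sup>2..(a + t)\<^sup>2}"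
    by (rule emeasure_mono) (auto simp: product_defect_def)
  moreover have "a\<^sup>2 \<le> (a + t)\<^sup>2" using 0 by (intro power_mono) auto
  ultimately show ?case by (metis (no_types, lifting) emeasure_lborel_Icc ennreal_leI order_trans)
next
  case (Suc N)
  let ?g = "{(a + t / 3) * (a + t)..(a + 2 * t / 3)\<^sup>2}"
  let ?e = "(t / 3)\<^sup>2 / 7 + 2 * (t / 3) * (2/3) ^ N"
  have e0: "0 \<le> ?e" using Suc.prems by simp
  have IH: "emeasure lborel (product_defect a (t / 3)) \<le> ennreal ?e"
    "emeasure lborel (product_defect (a + 2 * t / 3) (t / 3)) \<le> ennreal ?e"
    using Suc.prems by (intro Suc.IH; simp)+
  obtain s where t: "t = 3 * s" by (metis mult.commute nonzero_divide_eq_eq zero_neq_numeral)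
  have g: "(a + 2 * t / 3)\<^sup>2 - (a + t / 3) * (a + t) = t\<^sup>2 / 9"
    by (simp add: t power2_eq_square algebra_simps)
  have "emeasure lborel (product_defect a t) \<le> emeasure lborel
    (product_defect a (t / 3) \<union> product_defect (a + 2 * t / 3) (t / 3) \<union> ?g)"
    using product_defect_split[OF Suc.prems] by (intro emeasure_mono)
      (simp_all add: product_defect_borel sets.Un del: sets_lborel)
  also have "\<dots> \<le> emeasure lborel (product_defect a (t / 3) \<union> product_defect (a + 2 * t / 3) (t / 3))
    + emeasure lborel ?g"
    by (rule emeasure_subadditive) (simp_all add: product_defect_borel sets.Un del: sets_lborel)
  also have "\<dots> \<le> emeasure lborel (product_defect a (t / 3))
    + emeasure lborel (product_defect (a + 2 * t / 3) (t / 3)) + emeasure lborel ?g"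
    by (intro add_right_mono emeasure_subadditive product_defect_borel)
  also have "\<dots> \<le> ennreal ?e + ennreal ?e + ennreal (t\<^sup>2 / 9)"
    unfolding g[symmetric] by (intro add_mono IH) (simp add: emeasure_lborel_Icc_eq)
  also have "\<dots> = ennreal (?e + ?e + t\<^sup>2 / 9)"
    by (subst ennreal_plus[OF add_nonneg_nonneg[OF e0 e0]], simp, subst ennreal_plus[OF e0 e0], rule refl)
  also have "?e + ?e + t\<^sup>2 / 9 = t\<^sup>2 / 7 + 2 * t * (2/3) ^ Suc N"
    by (simp add: t power2_eq_square)
  finally show ?case .
qed

lemma emeasure_product_defect:
  assumes "2/3 \<le> a" "0 < t" "a + t \<le> 1"
  shows "emeasure lborel (product_defect a t) \<le> ennreal (t\<^sup>2 / 7)"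
proof (rule tendsto_lowerbound)
  have "(\<lambda>N. t\<^sup>2 / 7 + 2 * t * (2/3) ^ N) \<longlonglongrightarrow> t\<^sup>2 / 7 + 2 * t * 0"
    by (intro tendsto_intros LIMSEQ_power_zero) simp
  then show "(\<lambda>N. ennreal (t\<^sup>2 / 7 + 2 * t * (2/3) ^ N)) \<longlonglongrightarrow> ennreal (t\<^sup>2 / 7)"
    by (intro tendsto_ennrealI) simp
  show "\<forall>\<^sub>F N in sequentially. emeasure lborel (product_defect a t)
      \<le> ennreal (t\<^sup>2 / 7 + 2 * t * (2/3) ^ N)"
    using emeasure_product_defect_approx[OF assms] by simp
qed simp

subsection \<open>Cantor intervals\<close>

text \<open>Stated through the local shape of the Cantor set rather than triadic endpoints, so that
  nesting becomes composition of affine maps.\<close>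

definition cantor_interval :: "real \<Rightarrow> real \<Rightarrow> bool" where
  "cantor_interval a t \<longleftrightarrow>
     0 < t \<and> 0 \<le> a \<and> a + t \<le> 1 \<and> cantor_set \<inter> {a..a + t} = cantor_copy a t"

lemma cantor_intervalD:
  assumes "cantor_interval a t"
  shows "0 < t" "0 \<le> a" "a + t \<le> 1" "cantor_copy a t \<subseteq> cantor_set"
    "\<And>x. x \<in> cantor_set \<Longrightarrow> a \<le> x \<Longrightarrow> x \<le> a + t \<Longrightarrow> \<exists>u\<in>cantor_set. x = a + t * u"
proof -
  have A: "cantor_set \<inter> {a..a + t} = cantor_copy a t"
    and "0 < t" "0 \<le> a" "a + t \<le> 1"
    using assms unfolding cantor_interval_def by blast+
  then show "0 < t" "0 \<le> a" "a + t \<le> 1" by blast+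
  show "cantor_copy a t \<subseteq> cantor_set" unfolding A[symmetric] by blast
  fix x assume "x \<in> cantor_set" "a \<le> x" "x \<le> a + t"
  then have "x \<in> cantor_set \<inter> {a..a + t}" by simp
  then show "\<exists>u\<in>cantor_set. x = a + t * u" unfolding A cantor_copy_def by blast
qed

text \<open>The affine map from \<open>{0..1}\<close> onto \<open>{a..a + t}\<close> carries the
  Cantor set onto its part there, hence carries the copy in \<open>{c..c + s}\<close> onto the part
  in the image interval.\<close>

lemma cantor_interval_compose:
  assumes at: "cantor_interval a t" and cs: "cantor_interval c s"
  shows "cantor_interval (a + t * c) (t * s)"
proof -
  have t: "0 < t" "0 \<le> a" "a + t \<le> 1" and A: "cantor_set \<inter> {a..a + t} = cantor_copy a t"
    using at by (auto simp: cantor_interval_def)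
  have s: "0 < s" "0 \<le> c" "c + s \<le> 1" and C: "cantor_set \<inter> {c..c + s} = cantor_copy c s"
    using cs by (auto simp: cantor_interval_def)
  have le: "t * (c + s) \<le> t * 1" "0 \<le> t * c" using t s by (simp_all add: mult_left_mono)
  have copy: "cantor_copy (a + t * c) (t * s) = (\<lambda>u. a + t * u) ` cantor_copy c s"
    by (simp add: cantor_copy_def image_image algebra_simps)
  have "cantor_set \<inter> {a + t * c..a + t * c + t * s} = (\<lambda>u. a + t * u) ` cantor_copy c s"
  proof (intro subset_antisym subsetI)
    fix x assume x: "x \<in> cantor_set \<inter> {a + t * c..a + t * c + t * s}"
    then have "t * c \<le> x - a" "x - a \<le> t * (c + s)" by (simp_all add: distrib_left)
    then have "x \<in> cantor_set \<inter> {a..a + t}" using x le by simp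
    then have "x \<in> cantor_copy a t" unfolding A .
    then obtain u where u: "u \<in> cantor_set" "x = a + t * u" by (auto simp: cantor_copy_def)
    then have "t * c \<le> t * u" "t * u \<le> t * (c + s)" using x by (simp_all add: distrib_left)
    then have "u \<in> cantor_set \<inter> {c..c + s}" using t(1) u(1) by simp
    then have "u \<in> cantor_copy c s" unfolding C .
    then show "x \<in> (\<lambda>u. a + t * u) ` cantor_copy c s" using u(2) by blast
  next
    fix x assume "x \<in> (\<lambda>u. a + t * u) ` cantor_copy c s"
    then obtain u where "u \<in> cantor_copy c s" and xu: "x = a + t * u" by blast
    then have u: "u \<in> cantor_set" "c \<le> u" "u \<le> c + s" unfolding C[symmetric] by simp_all
    have "x \<in> cantor_copy a t" unfolding cantor_copy_def xu using u(1) by blast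
    then have "x \<in> cantor_set" unfolding A[symmetric] by blast
    moreover have "t * c \<le> t * u" "t * u \<le> t * (c + s)" using t u by (simp_all add: mult_left_mono)
    ultimately show "x \<in> cantor_set \<inter> {a + t * c..a + t * c + t * s}"
      using xu by (simp add: distrib_left)
  qed
  then show ?thesis
    unfolding cantor_interval_def copy using t s le by (simp add: distrib_left)
qed

lemma cantor_interval_unit: "cantor_interval 0 1"
  using cantor_set_subset by (auto simp: cantor_interval_def cantor_copy_def)

lemma cantor_interval_thirds:
  "cantor_interval 0 (1/3)" "cantor_interval (2/3) (1/3)"
proof -
  \<comment> \<open>The other digit in \<open>cantor_set_step\<close> would move the point out of
    \<open>{0..1}\<close>.\<close>
  have 1: "3 * x \<in> cantor_set" if "x \<in> cantor_set" "x \<le> 1/3" for x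
    using that cantor_set_step[of x] cantor_set_subset by (force simp: subset_iff)
  have 2: "3 * x - 2 \<in> cantor_set" if "x \<in> cantor_set" "2/3 \<le> x" for x
    using that cantor_set_step[of x] cantor_set_subset by (force simp: subset_iff)
  have "cantor_copy 0 (1/3) \<subseteq> cantor_set" "cantor_copy (2/3) (1/3) \<subseteq> cantor_set"
    using cantor_copy_thirds[of 0 1] by (auto simp: cantor_copy_def)
  moreover have "cantor_copy 0 (1/3) \<subseteq> {0..0+1/3}" "cantor_copy (2/3) (1/3) \<subseteq> {2/3..2/3+1/3}"
    using cantor_set_subset by (auto simp: cantor_copy_def)
  moreover have "x \<in> cantor_copy 0 (1/3)" if "x \<in> cantor_set \<inter> {0..0+1/3}" for x
    unfolding cantor_copy_def using 1[of x] that by (intro image_eqI[where x = "3 * x"]) auto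
  moreover have "x \<in> cantor_copy (2/3) (1/3)" if "x \<in> cantor_set \<inter> {2/3..2/3+1/3}" for x
    unfolding cantor_copy_def using 2[of x] that
    by (intro image_eqI[where x = "3 * x - 2"]) (auto simp: field_simps)
  ultimately show "cantor_interval 0 (1/3)" "cantor_interval (2/3) (1/3)"
    unfolding cantor_interval_def by (intro conjI subset_antisym subsetI; force)+
qed

lemma cantor_interval_left: "cantor_interval 0 (1 / 3 ^ k)"
proof (induction k)
  case (Suc k)
  from cantor_interval_compose[OF this cantor_interval_thirds(1)] show ?case
    by (simp add: mult.commute)
qed (simp add: cantor_interval_unit)

lemma cantor_interval_right: "cantor_interval (1 - 1 / 3 ^ k) (1 / 3 ^ k)"
proof (induction k)
  case (Suc k)
  have "1 - 1 / 3 ^ k + 1 / 3 ^ k * (2 / 3) = 1 - 1 / (3 ^ Suc k :: real)"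
    by (simp add: field_simps)
  then show ?case
    using cantor_interval_compose[OF Suc cantor_interval_thirds(2)] by (simp add: mult.commute)
qed (simp add: cantor_interval_unit)

lemma cantor_set_middle: "cantor_set \<inter> {1/3<..<2/3} = {}"
  using cantor_set_step cantor_set_subset by (fastforce simp: subset_iff)

subsection \<open>The gap set\<close>

text \<open>Both families reduce to the middle gap at \<open>m = 0\<close>, so the three parts merge
  into one union that is visibly symmetric under \<open>u \<mapsto> 1 - u\<close>.\<close>

lemma gap_set_eq:
  "gap_set = (\<Union>m. {1 / 3 ^ Suc m<..<2 / 3 ^ Suc m} \<union> {1 - 2 / 3 ^ Suc m<..<1 - 1 / 3 ^ Suc m})"
  (is "_ = ?U")
proof -
  have d: "(3 ^ (k + 1) - 2) / 3 ^ (k + 1) = 1 - 2 / (3 ^ Suc k :: real)"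
    "(3 ^ (k + 1) - 1) / 3 ^ (k + 1) = 1 - 1 / (3 ^ Suc k :: real)" for k
    by (simp_all add: field_simps)
  have z: "{1/3<..<2/3::real} = {1 / 3 ^ Suc 0<..<2 / 3 ^ Suc 0} \<union> {1 - 2 / 3 ^ Suc 0<..<1 - 1 / 3 ^ Suc 0}"
    by auto
  have U: "(UNIV :: nat set) = insert 0 {1..}" by auto
  have "(\<Union>m. f m) = f 0 \<union> (\<Union>m\<in>{1..}. f m)" for f :: "nat \<Rightarrow> real set"
    by (subst U) (rule UN_insert)
  from this[of "\<lambda>m. {1 / 3 ^ Suc m<..<2 / 3 ^ Suc m} \<union> {1 - 2 / 3 ^ Suc m<..<1 - 1 / 3 ^ Suc m}"]
  show ?thesis unfolding gap_set_def d z[symmetric] by (simp only: Suc_eq_plus1[symmetric] UN_Un_distrib) blast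
qed

lemma gap_set_mirror: "u \<in> gap_set \<Longrightarrow> 1 - u \<in> gap_set"
proof -
  assume "u \<in> gap_set"
  then obtain m where "u \<in> {1 / 3 ^ Suc m<..<2 / 3 ^ Suc m} \<union> {1 - 2 / 3 ^ Suc m<..<1 - 1 / 3 ^ Suc m}"
    unfolding gap_set_eq by blast
  then have "1 - u \<in> {1 / 3 ^ Suc m<..<2 / 3 ^ Suc m} \<union> {1 - 2 / 3 ^ Suc m<..<1 - 1 / 3 ^ Suc m}"
    by (auto simp del: power_Suc)
  then show ?thesis unfolding gap_set_eq by blast
qed

lemma open_gap_set: "open gap_set"
  unfolding gap_set_eq by (intro open_UN ballI open_Un) auto

lemma gap_set_subset: "gap_set \<subseteq> {0<..<1}"
proof -
  have "2 / 3 ^ Suc m \<le> (1::real)" for m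
  proof -
    have "1 \<le> (3::real) ^ m" by simp
    then have "2 \<le> 3 * (3::real) ^ m" by linarith
    then show ?thesis by simp
  qed
  moreover have "0 < 1 / (3 ^ Suc m :: real)" for m by simp
  ultimately have "{1 / 3 ^ Suc m<..<2 / 3 ^ Suc m :: real} \<subseteq> {0<..<1}"
    "{1 - 2 / 3 ^ Suc m<..<1 - 1 / 3 ^ Suc m :: real} \<subseteq> {0<..<1}" for m
    by (smt (verit) greaterThanLessThan_iff subsetI)+
  then show ?thesis unfolding gap_set_eq by blast
qed

lemma cantor_interval_middle:
  assumes "cantor_interval a t" shows "cantor_set \<inter> {a + t / 3<..<a + 2 * t / 3} = {}"
proof -
  have "x \<notin> cantor_set" if x: "a + t / 3 < x" "x < a + 2 * t / 3" for x
  proof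
    assume "x \<in> cantor_set"
    then obtain u where u: "u \<in> cantor_set" "x = a + t * u"
      using cantor_intervalD[OF assms] x by force
    then have "t * (1/3) < t * u" "t * u < t * (2/3)" using x by linarith+
    then have "1/3 < u" "u < 2/3"
      using cantor_intervalD(1)[OF assms] by (metis mult_less_cancel_left_pos)+
    then have "u \<in> cantor_set \<inter> {1/3<..<2/3}" using u(1) by simp
    then show False unfolding cantor_set_middle by simp
  qed
  then show ?thesis by auto
qed

text \<open>Every gap is the open middle third of a Cantor interval of length
  \<open>1 / 3 ^ m\<close> at one of the two ends of \<open>{0..1}\<close>.\<close>

lemma cantor_set_gap_disjoint: "cantor_set \<inter> gap_set = {}"
proof -
  have "1 - 1 / 3 ^ m + 1 / 3 ^ m / 3 = 1 - 2 / (3 ^ Suc m :: real)"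
    "1 - 1 / 3 ^ m + 2 * (1 / 3 ^ m) / 3 = 1 - 1 / (3 ^ Suc m :: real)" for m
    by (simp_all add: field_simps)
  then have "cantor_set \<inter> {1 - 2 / 3 ^ Suc m<..<1 - 1 / 3 ^ Suc m} = {}" for m
    using cantor_interval_middle[OF cantor_interval_right[of m]] by simp
  moreover have "cantor_set \<inter> {1 / 3 ^ Suc m<..<2 / 3 ^ Suc m} = {}" for m
    using cantor_interval_middle[OF cantor_interval_left[of m]] by (simp add: mult.commute)
  ultimately show ?thesis unfolding gap_set_eq by blast
qed

text \<open>The nondegenerate components of \<open>{0..1} - gap_set\<close> form two sequences, mirror images under
  \<open>x \<mapsto> 1 - x\<close>; the flag selects the one that accumulates at \<open>1\<close>.\<close>

definition child_start :: "bool \<Rightarrow> nat \<Rightarrow> real" where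
  "child_start m k = (if m then 1 - 1 / 3 ^ Suc k else 2 / 3 ^ Suc (Suc k))"

definition child_length :: "nat \<Rightarrow> real" where
  "child_length k = 1 / 3 ^ Suc (Suc k)"

abbreviation child :: "bool \<Rightarrow> nat \<Rightarrow> real set" where
  "child m k \<equiv> {child_start m k..child_start m k + child_length k}"

lemma child_False: "child False k = {2 / 3 ^ Suc (Suc k)..1 / 3 ^ Suc k}"
  and child_True: "child True k = {1 - 1 / 3 ^ Suc k..1 - 2 / 3 ^ Suc (Suc k)}"
  by (auto simp: child_start_def child_length_def field_simps)

lemma child_length_pos: "0 < child_length k"
  by (simp add: child_length_def)

text \<open>A child is the inner outer-third, away from the accumulation point, of a Cantor interval
  of length \<open>1 / 3 ^ Suc k\<close> at an end of \<open>{0..1}\<close>.\<close>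

lemma cantor_interval_child: "cantor_interval (child_start m k) (child_length k)"
proof (cases m)
  case True
  then show ?thesis
    using cantor_interval_compose[OF cantor_interval_right[of "Suc k"] cantor_interval_thirds(1)]
    by (simp add: child_start_def child_length_def mult.commute)
next
  case False
  then show ?thesis
    using cantor_interval_compose[OF cantor_interval_left[of "Suc k"] cantor_interval_thirds(2)]
    by (simp add: child_start_def child_length_def mult.commute)
qed

lemma child_subset: "child m k \<subseteq> {0..1}"
  using cantor_intervalD(2,3)[OF cantor_interval_child[of m k]] by auto

text \<open>In the indexing of \<open>gap_set_eq\<close>, left gaps of index above \<open>k\<close>
  lie below the left child, the other left gaps lie above it, and no right gap begins before 1/3.
  Reflection settles the right children.\<close>

lemma child_gap_disjoint: "child m k \<inter> gap_set = {}"
proof -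
  have far: "2 / 3 ^ Suc j \<le> 1 / (3 ^ k :: real)" "2 / 3 ^ j \<le> 2 / (3 ^ k :: real)"
    if "k \<le> j" for j k
  proof -
    have "1 / 3 ^ j \<le> 1 / (3 ^ k :: real)" "0 < 1 / (3 ^ k :: real)"
      using power_increasing[OF that, of "3::real"] by (simp_all add: frac_le)
    moreover have "2 / 3 ^ Suc j = 2/3 * (1 / 3 ^ j :: real)" "2 / 3 ^ j = 2 * (1 / 3 ^ j :: real)"
      "2 / 3 ^ k = 2 * (1 / 3 ^ k :: real)" by simp_all
    ultimately show "2 / 3 ^ Suc j \<le> 1 / (3 ^ k :: real)" "2 / 3 ^ j \<le> 2 / (3 ^ k :: real)"
      by linarith+
  qed
  have one': "1 / (3 ^ Suc j :: real) \<le> 1/3" for j using power_increasing[of 0 j "3::real"] by simp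
  have one: "2 / (3 ^ Suc j :: real) \<le> 2/3" for j using one'[of j] by linarith
  have L: "u \<notin> {1 / 3 ^ Suc j<..<2 / 3 ^ Suc j}"
    if "u \<in> {2 / 3 ^ Suc (Suc k)..1 / 3 ^ Suc k}" for u :: real and j k
  proof (cases "k < j")
    case True
    then show ?thesis using far(2)[of "Suc (Suc k)" "Suc j"] that by (simp del: power_Suc)
  next
    case False
    then have "1 / 3 ^ Suc k \<le> 1 / (3 ^ Suc j :: real)"
      using power_increasing[of "Suc j" "Suc k" "3::real"] by (simp add: field_simps)
    then show ?thesis using that by auto
  qed
  have R: "u \<notin> {1 - 2 / 3 ^ Suc j<..<1 - 1 / 3 ^ Suc j}"
    if "u \<in> {2 / 3 ^ Suc (Suc k)..1 / 3 ^ Suc k}" for u :: real and j k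
    using one[of j] one'[of k] that
    unfolding atLeastAtMost_iff greaterThanLessThan_iff by linarith
  have G: "u \<notin> gap_set" if "u \<in> child False k" for u
    unfolding gap_set_eq using L[OF that[unfolded child_False]] R[OF that[unfolded child_False]] by blast
  have "u \<notin> gap_set" if "u \<in> child True k" for u
  proof -
    have "1 - u \<in> child False k" using that unfolding child_False child_True by simp
    then show ?thesis using G gap_set_mirror by metis
  qed
  with G have "\<forall>u\<in>child m k. u \<notin> gap_set" by (cases m) metis+
  then show ?thesis by blast
qed

text \<open>These gaps isolate a child, which makes it a whole component. One of the two adjacent
  gaps is three times as long; the part of length \<open>child_length k\<close> is enough.\<close>

lemma child_neighbours:
  "{child_start m k - child_length k<..<child_start m k} \<subseteq> gap_set"
  "{child_start m k + child_length k<..<child_start m k + 2 * child_length k} \<subseteq> gap_set"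
proof -
  have "(1::real) / 3 ^ Suc k = 3 * (1 / 3 ^ Suc (Suc k))" "(2::real) / 3 ^ Suc k = 6 * (1 / 3 ^ Suc (Suc k))"
    "(2::real) / 3 ^ Suc (Suc k) = 2 * (1 / 3 ^ Suc (Suc k))" by simp_all
  moreover have "{1 / 3 ^ Suc k<..<2 / 3 ^ Suc k} \<subseteq> gap_set"
    "{1 - 2 / 3 ^ Suc k<..<1 - 1 / 3 ^ Suc k} \<subseteq> gap_set" for k unfolding gap_set_eq by blast+
  note this[of k] this[of "Suc k"]
  moreover have "0 < 1 / (3 ^ Suc (Suc k) :: real)" by simp
  ultimately show "{child_start m k - child_length k<..<child_start m k} \<subseteq> gap_set"
    "{child_start m k + child_length k<..<child_start m k + 2 * child_length k} \<subseteq> gap_set"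
    unfolding child_start_def child_length_def
    by (auto simp del: power_Suc simp: subset_iff)
qed

lemma third_powers_cover:
  assumes "0 < u" "u \<le> (1/3 :: real)"
  obtains k where "1 / 3 ^ Suc (Suc k) < u" "u \<le> 1 / 3 ^ Suc k"
proof -
  define k where "k = (LEAST k. 1 / 3 ^ Suc (Suc k) < u)"
  obtain n where "(1/3) ^ n < u" using real_arch_pow_inv[of u "1/3"] assms by auto
  moreover have "1 / 3 ^ Suc (Suc n) \<le> (1/3 :: real) ^ n" by (simp add: power_divide field_simps)
  ultimately have ex: "1 / 3 ^ Suc (Suc n) < u" by simp
  have "1 / 3 ^ Suc (Suc k) < u" unfolding k_def by (rule LeastI[of _ n]) (rule ex)
  moreover have "u \<le> 1 / 3 ^ Suc k"
  proof (cases k)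
    case (Suc j)
    then have "j < k" by simp
    then have "\<not> 1 / 3 ^ Suc (Suc j) < u" unfolding k_def by (rule not_less_Least)
    then show ?thesis using Suc by simp
  qed (use assms in simp)
  ultimately show thesis by (rule that)
qed

text \<open>A point of \<open>(0, 1/3]\<close> lies between two consecutive powers of 1/3, and
  removing the gap there leaves exactly a child. Points in \<open>[2/3, 1)\<close> follow by
  reflection, and 0 and 1 are the limits of the children.\<close>

lemma outside_gap_set:
  assumes "u \<in> {0..1}" "u \<notin> gap_set"
  shows "u = 0 \<or> (\<exists>k. u \<in> child False k) \<or> (\<exists>k. u \<in> child True k) \<or> u = 1"
proof -
  have gL: "u \<notin> {1 / 3 ^ Suc m<..<2 / 3 ^ Suc m}" and gR: "u \<notin> {1 - 2 / 3 ^ Suc m<..<1 - 1 / 3 ^ Suc m}" for m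
    using assms unfolding gap_set_eq by blast+
  consider "u = 0" | "0 < u" "u \<le> 1/3" | "2/3 \<le> u" "u < 1" | "u = 1"
    using assms(1) gL[of 0] unfolding atLeastAtMost_iff greaterThanLessThan_iff by fastforce
  then show ?thesis
  proof cases
    case 2
    obtain k where "1 / 3 ^ Suc (Suc k) < u" "u \<le> 1 / 3 ^ Suc k" by (rule third_powers_cover[OF 2])
    then have "u \<in> child False k" unfolding child_False using gL[of "Suc k"] by auto
    then show ?thesis by blast
  next
    case 3
    then have "0 < 1 - u" "1 - u \<le> 1/3" by auto
    then obtain k where "1 / 3 ^ Suc (Suc k) < 1 - u" "1 - u \<le> 1 / 3 ^ Suc k" by (rule third_powers_cover)
    then have "u \<in> child True k" unfolding child_True using gR[of "Suc k"] by auto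
    then show ?thesis by blast
  qed auto
qed

text \<open>If \<open>v\<close> is in the left child \<open>k\<close> and \<open>u\<close> is not,
  then \<open>u\<close> is at most \<open>1 / 3 ^ Suc (Suc k)\<close>, so the two lie in opposite
  thirds of \<open>{0..1 / 3 ^ Suc k}\<close>. The case of \<open>u\<close> in a right child is the
  mirror image. Away from both cases and the endpoints, \<open>{0..1}\<close> itself separates the
  points.\<close>

lemma outside_gap_set_pair:
  assumes "u \<in> {0..1} - gap_set" "v \<in> {0..1} - gap_set" "u \<le> v"
  obtains "u = v" "u = 0 \<or> u = 1"
  | m k where "u \<in> child m k" "v \<in> child m k"
  | c s where "cantor_interval c s" "u \<in> {c..c + s / 3}" "v \<in> {c + 2 * s / 3..c + s}"
proof -
  have gL: "w \<notin> {1 / 3 ^ Suc m<..<2 / 3 ^ Suc m}" and gR: "w \<notin> {1 - 2 / 3 ^ Suc m<..<1 - 1 / 3 ^ Suc m}"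
    if "w \<notin> gap_set" for w m using that unfolding gap_set_eq by blast+
  have pow: "1 / (3 ^ Suc k :: real) \<le> 1/3" for k
    using power_increasing[of 0 k "3::real"] by simp
  have lo: "w \<le> 1/3" if "w \<in> child False k" for w k
    using that pow[of k] unfolding child_False atLeastAtMost_iff by linarith
  have hi: "2/3 \<le> w" if "w \<in> child True k" for w k
    using that pow[of k] unfolding child_True atLeastAtMost_iff by linarith
  have "u \<in> {0..1}" "u \<notin> gap_set" "v \<in> {0..1}" "v \<notin> gap_set" "(0::real) \<le> 1/3" "(2/3::real) \<le> 1"
    using assms by simp_all
  then have U: "u \<le> 1/3 \<or> (\<exists>k. u \<in> child True k) \<or> u = 1"
    and V: "v = 0 \<or> (\<exists>k. v \<in> child False k) \<or> 2/3 \<le> v"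
    using lo hi outside_gap_set by metis+
  consider "v = 0" | k where "v \<in> child False k" | k where "u \<in> child True k" | "u = 1"
    | "u \<le> 1/3" "2/3 \<le> v"
    using U V by blast
  then show thesis
  proof cases
    case 1
    then show thesis using assms by (intro that(1)) auto
  next
    case (2 k)
    show thesis
    proof (cases "2 / 3 ^ Suc (Suc k) \<le> u")
      case True
      then show thesis
        using 2 assms(3) unfolding child_False
        by (intro that(2)[of False k, unfolded child_False]) (simp_all del: power_Suc)
    next
      case False
      then have "u \<le> 1 / 3 ^ Suc (Suc k)" using gL[of u "Suc k"] assms(1) by (simp del: power_Suc)
      moreover have "1 / 3 ^ Suc k / 3 = 1 / (3 ^ Suc (Suc k) :: real)"
        "2 * (1 / 3 ^ Suc k) / 3 = 2 / (3 ^ Suc (Suc k) :: real)" by simp_all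
      ultimately show thesis
        using 2 assms(1) unfolding child_False
        by (intro that(3)[OF cantor_interval_left[of "Suc k"]]) (simp_all del: power_Suc)
    qed
  next
    case (3 k)
    show thesis
    proof (cases "v \<le> 1 - 2 / 3 ^ Suc (Suc k)")
      case True
      then show thesis
        using 3 assms(3) unfolding child_True
        by (intro that(2)[of True k, unfolded child_True]) (simp_all del: power_Suc)
    next
      case False
      then have "1 - 1 / 3 ^ Suc (Suc k) \<le> v" using gR[of v "Suc k"] assms(2) by (simp del: power_Suc)
      moreover have "1 - 1 / 3 ^ Suc k + 1 / 3 ^ Suc k / 3 = 1 - 2 / (3 ^ Suc (Suc k) :: real)"
        "1 - 1 / 3 ^ Suc k + 2 * (1 / 3 ^ Suc k) / 3 = 1 - 1 / (3 ^ Suc (Suc k) :: real)"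
        by (simp_all add: field_simps)
      ultimately show thesis
        using 3 assms(2) unfolding child_True
        by (intro that(3)[OF cantor_interval_right[of "Suc k"]]) (simp_all del: power_Suc)
    qed
  next
    case 4
    then show thesis using assms by (intro that(1)) auto
  next
    case 5
    then show thesis using assms by (intro that(3)[OF cantor_interval_unit]) auto
  qed
qed

subsection \<open>Components of the fast subdivision\<close>

lemma interval_map_Icc: "0 < t \<Longrightarrow> interval_map {a..a + t} = (\<lambda>x. a + t * x)"
  by (simp add: interval_map_def fun_eq_iff)

lemma interval_map_gap_set_subset: "0 < t \<Longrightarrow> interval_map {a..a + t} ` gap_set \<subseteq> {a..a + t}"
  unfolding interval_map_Icc using gap_set_subset by (fastforce simp: subset_iff)

lemma child_image:
  "0 < t \<Longrightarrow> (\<lambda>u. a + t * u) ` child m k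
    = {a + t * child_start m k..a + t * child_start m k + t * child_length k}"
  using image_affinity_atLeastAtMost[of t a "child_start m k" "child_start m k + child_length k"]
    child_length_pos[of k]
  by (simp add: algebra_simps)

text \<open>Within an old component, \<open>S'\<close> is an affine image of
  \<open>{0..1} - gap_set\<close>. A child is a component because gaps adjoin it on both sides.
  Conversely, a fat component of \<open>S'\<close> sits inside a fat component of \<open>S\<close>,
  and an interior point of it is not an endpoint there, so it lies in a child.\<close>

lemma fat_components_remove_gaps:
  assumes fat: "fat_components S = (\<lambda>(a, t). {a..a + t}) ` F"
    and pos: "\<And>a t. (a, t) \<in> F \<Longrightarrow> 0 < t"
  defines "S' \<equiv> S - (\<Union>I\<in>fat_components S. interval_map I ` gap_set)"
  shows "fat_components S' = (\<lambda>(a, t). {a..a + t}) `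
    (\<Union>(a, t)\<in>F. \<Union>m k. {(a + t * child_start m k, t * child_length k)})" (is "_ = ?R")
proof -
  have comp: "{a..a + t} \<in> components S" if "(a, t) \<in> F" for a t
  proof -
    have "{a..a + t} \<in> fat_components S" unfolding fat using that by force
    then show ?thesis by (simp add: fat_components_def)
  qed
  have inI: "x \<in> S' \<longleftrightarrow> x \<notin> interval_map {a..a + t} ` gap_set"
    if at: "(a, t) \<in> F" and x: "x \<in> {a..a + t}" for a t x
  proof -
    have "x \<in> S" using in_components_subset[OF comp[OF at]] x by blast
    \<comment> \<open>Gaps removed from other components cannot contain \<open>x\<close>, since
      components are disjoint.\<close>
    moreover have "{a..a + t} = I" if "I \<in> fat_components S" "x \<in> interval_map I ` gap_set" for I
    proof -
      have "I \<in> (\<lambda>(a, t). {a..a + t}) ` F" using that(1) unfolding fat .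
      then obtain b s where bs: "I = {b..b + s}" "(b, s) \<in> F" by auto
      then have "x \<in> I" using that(2) interval_map_gap_set_subset[OF pos[OF bs(2)]] by blast
      then show ?thesis using components_nonoverlap[OF comp[OF at], of I] comp[OF bs(2)] bs(1) x by blast
    qed
    moreover have "{a..a + t} \<in> fat_components S" unfolding fat using at by force
    ultimately show ?thesis unfolding S'_def by blast
  qed
  have S'S: "S' \<subseteq> S" unfolding S'_def by blast
  have child: "{a + t * child_start m k..a + t * child_start m k + t * child_length k} \<in> components S'"
    if at: "(a, t) \<in> F" for a t m k
  proof -
    define lo hi where "lo = a + t * child_start m k" and "hi = lo + t * child_length k"
    have t: "0 < t" "0 < t * child_length k" using pos[OF at] child_length_pos by simp_all
    have J: "{lo..hi} = (\<lambda>u. a + t * u) ` child m k"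
      unfolding lo_def hi_def using child_image[OF t(1)] by simp
    have JI: "{lo..hi} \<subseteq> {a..a + t}"
      unfolding J using child_subset[of m k] t(1) by (fastforce simp: subset_iff)
    have "x \<in> S'" if "x \<in> {lo..hi}" for x
    proof -
      have "inj (\<lambda>u. a + t * u)" using t(1) by (simp add: inj_on_def)
      then have "{lo..hi} \<inter> interval_map {a..a + t} ` gap_set = {}"
        unfolding J interval_map_Icc[OF t(1)] using child_gap_disjoint
        by (simp add: image_Int[symmetric])
      then show ?thesis using inI[OF at, of x] JI that by blast
    qed
    then have JS: "{lo..hi} \<subseteq> S'" by blast
    have "d = {lo..hi}" if d: "{lo..hi} \<subseteq> d" "d \<subseteq> S'" "connected d" for d
    proof -
      have lohi: "lo < hi" using t by (simp add: hi_def)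
      then have mem: "lo \<in> d" "hi \<in> d" using d(1) by auto
      have dI: "d \<subseteq> {a..a + t}"
        using components_maximal[OF comp[OF at] d(3)] d(2) S'S mem(1) JI lohi by fastforce
      have nogap: "p \<notin> d" if "(p - a) / t \<in> gap_set" for p
      proof
        assume p: "p \<in> d"
        have "p \<in> interval_map {a..a + t} ` gap_set"
          unfolding interval_map_Icc[OF t(1)] using that t(1)
          by (intro image_eqI[where x = "(p - a) / t"]) simp_all
        then show False using inI[OF at, of p] p dI d(2) by blast
      qed
      have "lo \<le> x" if x: "x \<in> d" for x
      proof (rule ccontr)
        assume "\<not> lo \<le> x"
        \<comment> \<open>A point between \<open>x\<close> and \<open>lo\<close> inside the adjacent
          gap; connectedness would force it into \<open>d\<close>.\<close>
        define p where "p = (max x (lo - t * child_length k) + lo) / 2"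
        have p: "x \<le> p" "p < lo" "lo - t * child_length k < p"
          using \<open>\<not> lo \<le> x\<close> t(2) by (auto simp: p_def)
        then have "p \<in> d" using connected_contains_Icc[OF d(3) x mem(1)] by auto
        moreover have "t * (child_start m k - child_length k) < p - a" "p - a < t * child_start m k"
          using p by (simp_all add: lo_def right_diff_distrib)
        then have "(p - a) / t \<in> {child_start m k - child_length k<..<child_start m k}"
          using t(1) by (simp add: pos_less_divide_eq pos_divide_less_eq mult.commute)
        ultimately show False using nogap child_neighbours(1) by blast
      qed
      moreover have "x \<le> hi" if x: "x \<in> d" for x
      proof (rule ccontr)
        assume "\<not> x \<le> hi"
        define p where "p = (min x (hi + t * child_length k) + hi) / 2"
        have p: "p \<le> x" "hi < p" "p < hi + t * child_length k"
          using \<open>\<not> x \<le> hi\<close> t(2) by (auto simp: p_def)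
        then have "p \<in> d" using connected_contains_Icc[OF d(3) mem(2) x] by auto
        moreover have "t * (child_start m k + child_length k) < p - a"
          "p - a < t * (child_start m k + 2 * child_length k)"
          using p by (simp_all add: lo_def hi_def distrib_left)
        then have "(p - a) / t \<in>
            {child_start m k + child_length k<..<child_start m k + 2 * child_length k}"
          using t(1) by (simp add: pos_less_divide_eq pos_divide_less_eq mult.commute)
        ultimately show False using nogap child_neighbours(2) by blast
      qed
      ultimately show ?thesis using d(1) by (intro subset_antisym subsetI) auto
    qed
    moreover have "lo \<le> hi" using t by (simp add: hi_def)
    ultimately have "{lo..hi} \<in> components S'"
      unfolding in_components_maximal using JS by (auto simp del: atLeastatMost_subset_iff)
    then show ?thesis by (simp add: lo_def hi_def)
  qed
  show ?thesis
  proof (intro subset_antisym subsetI)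
    fix J assume "J \<in> ?R"
    then obtain a t m k where at: "(a, t) \<in> F"
      and J: "J = {a + t * child_start m k..a + t * child_start m k + t * child_length k}" by auto
    have "0 < t * child_length k" using pos[OF at] child_length_pos by simp
    then have "interior J \<noteq> {}" unfolding J interior_atLeastAtMost_real by simp
    then show "J \<in> fat_components S'" using child[OF at] J by (simp add: fat_components_def)
  next
    fix C assume "C \<in> fat_components S'"
    then have C: "C \<in> components S'" and int: "interior C \<noteq> {}" by (simp_all add: fat_components_def)
    have "C \<subseteq> S" "connected C" "C \<noteq> {}"
      using C S'S in_components_subset in_components_connected in_components_nonempty by blast+
    then obtain I where I: "I \<in> components S" "C \<subseteq> I"
      using exists_component_superset[of C S] by auto
    then have "I \<in> fat_components S"
      using int interior_mono[OF I(2)] by (auto simp: fat_components_def)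
    then obtain a t where at: "(a, t) \<in> F" "I = {a..a + t}" unfolding fat by auto
    obtain x where x: "x \<in> interior C" using int by blast
    have xC: "x \<in> C" using x interior_subset by blast
    have "x \<in> {a<..<a + t}" using x interior_mono[OF I(2)] unfolding at(2) interior_atLeastAtMost_real by blast
    then have xa: "a < x" "x < a + t" by simp_all
    define u where "u = (x - a) / t"
    have t: "0 < t" using pos[OF at(1)] .
    have u: "u \<in> {0<..<1}" "x = a + t * u" using xa t by (simp_all add: u_def)
    have "x \<in> S'" using xC C in_components_subset by blast
    then have "x \<notin> interval_map {a..a + t} ` gap_set" using inI[OF at(1), of x] xa by simp
    then have "u \<notin> gap_set" unfolding interval_map_Icc[OF t] u(2) by blast
    moreover have "u \<in> {0..1}" "u \<noteq> 0" "u \<noteq> 1" using u(1) by simp_all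
    ultimately obtain m k where "u \<in> child m k" using outside_gap_set[of u] by blast
    then have "x \<in> {a + t * child_start m k..a + t * child_start m k + t * child_length k}"
      unfolding child_image[OF t, symmetric] u(2) by blast
    then have "C = {a + t * child_start m k..a + t * child_start m k + t * child_length k}"
      using components_nonoverlap[OF C child[OF at(1), of m k]] xC by blast
    then show "C \<in> ?R" using at(1) by force
  qed
qed

section \<open>Components of all levels, recorded as left endpoint and length\<close>

fun fast_intervals :: "nat \<Rightarrow> real \<Rightarrow> real \<Rightarrow> (real \<times> real) set" where
  "fast_intervals 0 a t = {(a, t)}"
| "fast_intervals (Suc n) a t =
     (\<Union>(b, s)\<in>fast_intervals n a t. \<Union>m k. {(b + s * child_start m k, s * child_length k)})"

text \<open>The definition refines the smallest intervals, as the subdivision does. Unfolding at the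
  root instead lets the measure estimate pass from an interval to its children by induction.\<close>

lemma fast_intervals_Suc_top:
  "fast_intervals (Suc n) a t =
     (\<Union>m k. fast_intervals n (a + t * child_start m k) (t * child_length k))"
proof (induction n)
  case (Suc n)
  have "fast_intervals (Suc (Suc n)) a t =
    (\<Union>(b, s)\<in>(\<Union>m k. fast_intervals n (a + t * child_start m k) (t * child_length k)).
      \<Union>m k. {(b + s * child_start m k, s * child_length k)})"
    unfolding Suc[symmetric] by (rule fast_intervals.simps(2))
  also have "\<dots> = (\<Union>m k. fast_intervals (Suc n) (a + t * child_start m k) (t * child_length k))"
    unfolding fast_intervals.simps(2) UN_UN_flatten ..
  finally show ?case .
qed simp

lemma fast_intervals_cantor:
  assumes "cantor_interval a t" "(b, s) \<in> fast_intervals n a t"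
  shows "cantor_interval b s \<and> a \<le> b"
  using assms(2)
proof (induction n arbitrary: b s)
  case (Suc n)
  then obtain b' s' m k where IH: "(b', s') \<in> fast_intervals n a t"
    and b: "b = b' + s' * child_start m k" "s = s' * child_length k" by auto
  have "cantor_interval b' s'" "a \<le> b'" using Suc.IH[OF IH] by auto
  moreover have "0 \<le> s' * child_start m k"
    using cantor_intervalD(1)[OF \<open>cantor_interval b' s'\<close>] cantor_intervalD(2)[OF cantor_interval_child]
    by simp
  ultimately show ?case unfolding b using cantor_interval_compose cantor_interval_child by auto
qed (use assms in auto)

lemma fast_intervals_right:
  assumes "(b, s) \<in> fast_intervals n (2/3) (1/3)"
  shows "cantor_interval b s" "2/3 \<le> b"
  using fast_intervals_cantor[OF cantor_interval_thirds(2) assms] by auto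

lemma fat_components_fast_subdivision:
  "fat_components (fast_subdivision n) = (\<lambda>(a, t). {a..a + t}) ` fast_intervals n (2/3) (1/3)"
proof (induction n)
  case 0
  have "components {2/3..1::real} = {{2/3..1}}"
    by (subst components_eq_sing_iff) simp
  then show ?case by (auto simp: fat_components_def interior_atLeastAtMost_real)
next
  case (Suc n)
  show ?case
    unfolding fast_subdivision.simps fast_intervals.simps
    by (rule fat_components_remove_gaps[OF Suc]) (use fast_intervals_right cantor_intervalD(1) in blast)
qed

lemma compact_fast_subdivision: "compact (fast_subdivision n)"
proof (induction n)
  case (Suc n)
  have "open (interval_map I ` gap_set)" if I: "I \<in> fat_components (fast_subdivision n)" for I
  proof -
    obtain a t where at: "I = {a..a + t}" "(a, t) \<in> fast_intervals n (2/3) (1/3)"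
      using I unfolding fat_components_fast_subdivision by auto
    have t: "0 < t" using cantor_intervalD(1)[OF fast_intervals_right(1)[OF at(2)]] .
    then show ?thesis
      unfolding at(1) interval_map_Icc[OF t] using open_affinity[OF open_gap_set, of t a] by simp
  qed
  then show ?case using Suc by (simp add: compact_diff open_UN)
qed simp

text \<open>Components are Cantor intervals, so a Cantor point has a Cantor coordinate inside its
  component, and such coordinates avoid \<open>gap_set\<close>.\<close>

lemma right_cantor_set_subset_fast_subdivision: "right_cantor_set \<subseteq> fast_subdivision n"
proof (induction n)
  case (Suc n)
  have "x \<notin> interval_map I ` gap_set"
    if x: "x \<in> right_cantor_set" and I: "I \<in> fat_components (fast_subdivision n)" for x I
  proof
    assume g: "x \<in> interval_map I ` gap_set"
    obtain a t where at: "I = {a..a + t}" "(a, t) \<in> fast_intervals n (2/3) (1/3)"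
      using I unfolding fat_components_fast_subdivision by auto
    note ci = fast_intervals_right(1)[OF at(2)]
    note t = cantor_intervalD(1)[OF ci]
    have "x \<in> {a..a + t}" using g interval_map_gap_set_subset[OF t, of a] unfolding at(1) by blast
    then obtain v where v: "v \<in> cantor_set" "x = a + t * v"
      using cantor_intervalD(5)[OF ci, of x] x by (auto simp: right_cantor_set_def)
    obtain u where "u \<in> gap_set" "x = a + t * u"
      using g unfolding at(1) interval_map_Icc[OF t] by blast
    then have "v \<in> gap_set" using v(2) t by simp
    then show False using v(1) cantor_set_gap_disjoint by blast
  qed
  then show ?case using Suc by auto
qed (auto simp: right_cantor_set_def)

lemma compact_right_cantor_set: "compact right_cantor_set"
  unfolding right_cantor_set_def by (intro compact_Int_closed compact_cantor_set) simp

lemma cantor_copy_subset_right: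
  assumes "cantor_interval a t" "2/3 \<le> a"
  shows "cantor_copy a t \<subseteq> right_cantor_set"
proof -
  have "2/3 \<le> a + t * u" if "u \<in> cantor_set" for u
    using that assms(2) cantor_set_subset cantor_intervalD(1)[OF assms(1)]
    by (intro add_increasing2) auto
  then show ?thesis
    using cantor_intervalD(4)[OF assms(1)] cantor_set_subset
    unfolding right_cantor_set_def cantor_copy_def by (auto simp: subset_iff)
qed

section \<open>Products of two points of the fast subdivision\<close>

lemma prod_map_mono: "A \<subseteq> A' \<Longrightarrow> B \<subseteq> B' \<Longrightarrow> prod_map ` (A \<times> B) \<subseteq> prod_map ` (A' \<times> B')"
  by (intro image_mono Sigma_mono) auto

text \<open>Two points sharing a component of level \<open>n\<close> are compared through their
  coordinates by \<open>outside_gap_set_pair\<close>. A common endpoint belongs to the right Cantor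
  set, and a common child is a component of the next level. For points in opposite thirds,
  \<open>prod_map_separated\<close> represents the product with other factors, since
  \<open>x\<close> and \<open>y\<close> need not be Cantor points.\<close>

lemma fast_subdivision_prod_cases:
  assumes "x \<in> fast_subdivision n" "y \<in> fast_subdivision n" "x \<le> y"
  shows "x * y \<in> prod_map ` (right_cantor_set \<times> right_cantor_set) \<or>
    (\<exists>(b, s)\<in>fast_intervals n (2/3) (1/3). x \<in> {b..b + s} \<and> y \<in> {b..b + s})"
  using assms(1,2)
proof (induction n)
  case (Suc n)
  have old: "x \<in> fast_subdivision n" "y \<in> fast_subdivision n" using Suc.prems by simp_all
  consider "x * y \<in> prod_map ` (right_cantor_set \<times> right_cantor_set)"
    | b s where "(b, s) \<in> fast_intervals n (2/3) (1/3)" "x \<in> {b..b + s}" "y \<in> {b..b + s}"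
    using Suc.IH[OF old] by blast
  then show ?case
  proof cases
    case (2 b s)
    note ci = fast_intervals_right[OF 2(1)]
    have s: "0 < s" using cantor_intervalD(1)[OF ci(1)] .
    define u v where "u = (x - b) / s" and "v = (y - b) / s"
    have xy: "x = b + s * u" "y = b + s * v" using s by (simp_all add: u_def v_def)
    have "{b..b + s} \<in> fat_components (fast_subdivision n)"
      unfolding fat_components_fast_subdivision using 2(1) by force
    then have "x \<notin> interval_map {b..b + s} ` gap_set" "y \<notin> interval_map {b..b + s} ` gap_set"
      using Suc.prems by auto
    then have "u \<notin> gap_set" "v \<notin> gap_set" unfolding interval_map_Icc[OF s] xy by blast+
    moreover have "u \<in> {0..1}" "v \<in> {0..1}" using 2(2,3) s by (auto simp: u_def v_def)
    ultimately have "u \<in> {0..1} - gap_set" "v \<in> {0..1} - gap_set" by simp_all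
    moreover have "u \<le> v" using assms(3) s by (simp add: u_def v_def divide_right_mono)
    ultimately show ?thesis
    proof (cases rule: outside_gap_set_pair)
      case 1
      have "x = b \<or> x = b + s" using 1(2) xy(1) by auto
      then have "x \<in> cantor_copy b s" using cantor_copy_ends[of b s] by metis
      then have "x \<in> right_cantor_set" using cantor_copy_subset_right[OF ci] by blast
      moreover have "y = x" using 1(1) xy by simp
      ultimately show ?thesis unfolding prod_map_image by blast
    next
      case (2 m k)
      then have "x \<in> (\<lambda>u. b + s * u) ` child m k" "y \<in> (\<lambda>u. b + s * u) ` child m k"
        using xy by blast+
      moreover have "(b + s * child_start m k, s * child_length k) \<in> fast_intervals (Suc n) (2/3) (1/3)"
        unfolding fast_intervals.simps using \<open>(b, s) \<in> fast_intervals n (2/3) (1/3)\<close> by fast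
      ultimately show ?thesis unfolding child_image[OF s] by blast
    next
      case (3 c r)
      define a t where "a = b + s * c" and "t = s * r"
      have A: "cantor_interval a t"
        unfolding a_def t_def by (rule cantor_interval_compose[OF ci(1) 3(1)])
      have "0 \<le> s * c" using s cantor_intervalD(2)[OF 3(1)] by simp
      then have a: "2/3 \<le> a" using ci(2) by (simp add: a_def)
      note t = cantor_intervalD(1,3)[OF A]
      have "s * c \<le> s * u" "s * u \<le> s * (c + r / 3)" "s * (c + 2 * r / 3) \<le> s * v" "s * v \<le> s * (c + r)"
        using 3(2,3) s by simp_all
      then have "a \<le> x" "x \<le> a + t / 3" "a + 2 * t / 3 \<le> y" "y \<le> a + 2 * t / 3 + t / 3"
        by (simp_all add: xy a_def t_def algebra_simps)
      then have "x * y \<in> {a * (a + 2 * t / 3)..(a + t / 3) * (a + 2 * t / 3 + t / 3)}"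
        using a t(1) by (auto intro!: mult_mono)
      also have "\<dots> \<subseteq> prod_map ` (cantor_copy a (t / 3) \<times> cantor_copy (a + 2 * t / 3) (t / 3))"
        using a t by (intro prod_map_separated) auto
      also have "\<dots> \<subseteq> prod_map ` (right_cantor_set \<times> right_cantor_set)"
        using cantor_copy_thirds cantor_copy_subset_right[OF A a] by (intro prod_map_mono) blast+
      finally show ?thesis ..
    qed
  qed simp
qed (auto simp: right_cantor_set_def)

section \<open>Measure of the total defect\<close>

definition fast_defect :: "nat \<Rightarrow> real \<Rightarrow> real \<Rightarrow> real set" where
  "fast_defect n a t = (\<Union>(b, s)\<in>fast_intervals n a t. product_defect b s)"

lemma fast_defect_0: "fast_defect 0 a t = product_defect a t"
  by (simp add: fast_defect_def)

lemma fast_defect_Suc: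
  "fast_defect (Suc n) a t = (\<Union>k.
     fast_defect n (a + t * child_start False k) (t * child_length k) \<union>
     fast_defect n (a + t * child_start True k) (t * child_length k))"
  unfolding fast_defect_def fast_intervals_Suc_top UNIV_bool by blast

lemma fast_defect_measurable: "fast_defect n a t \<in> sets lborel"
  by (induction n arbitrary: a t)
    (simp_all only: fast_defect_0 fast_defect_Suc product_defect_borel sets.Un
      sets.countable_UN image_subset_iff ball_UNIV simp_thms)

text \<open>The factor 2 counts the left and the right child of each length; the series is geometric
  with first term 2/81 and ratio 1/9.\<close>

lemma child_length_squares_sum: "(\<lambda>k. 2 * (child_length k)\<^sup>2) sums (1/36)"
proof -
  have "(\<lambda>k. 2/81 * (1/9) ^ k) sums (2/81 * (1 / (1 - 1/9)) :: real)"
    by (intro sums_mult geometric_sums) simp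
  moreover have "2 * (child_length k)\<^sup>2 = 2/81 * (1/9) ^ k" for k
  proof -
    have "(3 ^ k)\<^sup>2 = (9::real) ^ k" by (simp add: power_mult_distrib[symmetric] power2_eq_square)
    then show ?thesis by (simp add: child_length_def power2_eq_square power_divide)
  qed
  ultimately show ?thesis by (simp only:) simp
qed

text \<open>Unfolding at the root, the bounds of the children add up, and their squared lengths sum
  to \<open>t\<^sup>2 / 36\<close>. The case of depth 0 is
  \<open>emeasure_product_defect\<close>.\<close>

lemma emeasure_fast_defect:
  assumes "cantor_interval a t" "2/3 \<le> a"
  shows "emeasure lborel (fast_defect n a t) \<le> ennreal (t\<^sup>2 / 7 * (1/36) ^ n)"
  using assms
proof (induction n arbitrary: a t)
  case 0
  then show ?case
    using emeasure_product_defect[of a t] cantor_intervalD(1,3)[OF 0(1)] by (simp add: fast_defect_0)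
next
  case (Suc n)
  let ?D = "\<lambda>m k. fast_defect n (a + t * child_start m k) (t * child_length k)"
  define e where "e k = (t * child_length k)\<^sup>2 / 7 * (1/36) ^ n" for k
  have D: "emeasure lborel (?D m k) \<le> ennreal (e k)" for m k
    unfolding e_def
  proof (rule Suc.IH)
    show "cantor_interval (a + t * child_start m k) (t * child_length k)"
      by (rule cantor_interval_compose[OF Suc.prems(1) cantor_interval_child])
    have "0 \<le> t * child_start m k"
      using cantor_intervalD(1)[OF Suc.prems(1)] cantor_intervalD(2)[OF cantor_interval_child[of m k]] by simp
    then show "2/3 \<le> a + t * child_start m k" using Suc.prems(2) by simp
  qed
  have e0: "0 \<le> e k" for k by (simp add: e_def)
  have U: "emeasure lborel (?D False k \<union> ?D True k) \<le> ennreal (2 * e k)" for k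
  proof -
    have "emeasure lborel (?D False k \<union> ?D True k) \<le> emeasure lborel (?D False k) + emeasure lborel (?D True k)"
      by (intro emeasure_subadditive fast_defect_measurable)
    also have "\<dots> \<le> ennreal (e k) + ennreal (e k)" by (intro add_mono D)
    also have "\<dots> = ennreal (2 * e k)" by (simp only: ennreal_plus[OF e0 e0, symmetric] mult_2)
    finally show ?thesis .
  qed
  have "(\<lambda>k. t\<^sup>2 / 7 * (1/36) ^ n * (2 * (child_length k)\<^sup>2)) sums (t\<^sup>2 / 7 * (1/36) ^ n * (1/36))"
    by (intro sums_mult child_length_squares_sum)
  then have sum: "(\<lambda>k. 2 * e k) sums (t\<^sup>2 / 7 * (1/36) ^ Suc n)"
    by (simp add: e_def power_mult_distrib mult_ac)
  have "emeasure lborel (fast_defect (Suc n) a t) \<le> (\<Sum>k. emeasure lborel (?D False k \<union> ?D True k))"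
    unfolding fast_defect_Suc
    by (intro emeasure_subadditive_countably)
      (auto intro!: sets.Un fast_defect_measurable simp del: sets_lborel)
  also have "\<dots> \<le> (\<Sum>k. ennreal (2 * e k))" by (intro suminf_le U) auto
  also have "\<dots> = ennreal (t\<^sup>2 / 7 * (1/36) ^ Suc n)"
    by (rule suminf_ennreal_eq[OF _ sum]) (simp add: e0)
  finally show ?case .
qed

text \<open>Products of two points in one component either come from its Cantor copy or belong to
  its defect; all others are covered by \<open>fast_subdivision_prod_cases\<close>, which
  commutativity extends to unordered pairs.\<close>

lemma fast_subdivision_prod_subset:
  "prod_map ` (fast_subdivision n \<times> fast_subdivision n)
    \<subseteq> prod_map ` (right_cantor_set \<times> right_cantor_set) \<union> fast_defect n (2/3) (1/3)"
proof -
  have ordered: "x * y \<in> prod_map ` (right_cantor_set \<times> right_cantor_set) \<union> fast_defect n (2/3) (1/3)"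
    if xy: "x \<in> fast_subdivision n" "y \<in> fast_subdivision n" "x \<le> y" for x y
    using fast_subdivision_prod_cases[OF xy]
  proof (elim disjE bexE)
    fix p assume p: "p \<in> fast_intervals n (2/3) (1/3)"
      "case p of (b, s) \<Rightarrow> x \<in> {b..b + s} \<and> y \<in> {b..b + s}"
    obtain b s where bs: "p = (b, s)" by (cases p)
    have b: "(b, s) \<in> fast_intervals n (2/3) (1/3)" "b \<le> x" "x \<le> b + s" "b \<le> y" "y \<le> b + s"
      using p unfolding bs by auto
    note ci = fast_intervals_right[OF b(1)]
    have "x * y \<in> {b\<^sup>2..(b + s)\<^sup>2}"
      unfolding power2_eq_square using b ci(2) by (auto intro!: mult_mono)
    then consider "x * y \<in> prod_map ` (cantor_copy b s \<times> cantor_copy b s)" | "x * y \<in> product_defect b s"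
      unfolding product_defect_def by blast
    then show ?thesis
    proof cases
      case 1
      then show ?thesis
        using prod_map_mono[OF cantor_copy_subset_right[OF ci] cantor_copy_subset_right[OF ci]] by blast
    next
      case 2
      then show ?thesis using b(1) unfolding fast_defect_def by blast
    qed
  qed blast
  show ?thesis
  proof
    fix z assume "z \<in> prod_map ` (fast_subdivision n \<times> fast_subdivision n)"
    then obtain x y where "x \<in> fast_subdivision n" "y \<in> fast_subdivision n" "z = x * y"
      unfolding prod_map_image by blast
    then show "z \<in> prod_map ` (right_cantor_set \<times> right_cantor_set) \<union> fast_defect n (2/3) (1/3)"
      using ordered[of x y] ordered[of y x] by (metis linear mult.commute)
  qed
qed

section \<open>Comparison of the two product measures\<close>

theorem proposition1p2:
  fixes n :: nat
  shows "0 \<le> measure lebesgue (prod_map ` (fast_subdivision n \<times> fast_subdivision n))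
             - measure lebesgue (prod_map ` (right_cantor_set \<times> right_cantor_set))
         \<and> measure lebesgue (prod_map ` (fast_subdivision n \<times> fast_subdivision n))
             - measure lebesgue (prod_map ` (right_cantor_set \<times> right_cantor_set))
           \<le> (1 / 63) * (1 / 36) ^ n"
proof -
  let ?D = "prod_map ` (fast_subdivision n \<times> fast_subdivision n)"
  let ?R = "prod_map ` (right_cantor_set \<times> right_cantor_set)"
  let ?M = "fast_defect n (2/3) (1/3)"
  let ?e = "1 / 63 * (1 / 36) ^ n :: real"
  have D: "compact ?D" and R: "compact ?R"
    by (intro compact_prod_map compact_fast_subdivision compact_right_cantor_set)+
  have m: "emeasure lborel A = ennreal (measure lborel A)" if "compact A" for A :: "real set"
    using that
    by (intro emeasure_eq_ennreal_measure)
      (metis compact_imp_bounded emeasure_bounded_finite infinity_ennreal_def less_irrefl)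
  have sub: "?R \<subseteq> ?D"
    using right_cantor_set_subset_fast_subdivision by (intro prod_map_mono)
  have "emeasure lborel ?R \<le> emeasure lborel ?D"
    using sub borel_compact[OF D] by (intro emeasure_mono) simp_all
  then have lower: "measure lborel ?R \<le> measure lborel ?D" by (simp add: m[OF D] m[OF R])
  have "emeasure lborel ?D \<le> emeasure lborel (?R \<union> ?M)"
    using fast_subdivision_prod_subset borel_compact[OF R] fast_defect_measurable
    by (intro emeasure_mono sets.Un) simp_all
  also have "\<dots> \<le> emeasure lborel ?R + emeasure lborel ?M"
    using borel_compact[OF R] fast_defect_measurable by (intro emeasure_subadditive) simp_all
  also have "\<dots> \<le> ennreal (measure lborel ?R) + ennreal ((1/3)\<^sup>2 / 7 * (1/36) ^ n)"
    unfolding m[OF R] by (intro add_left_mono emeasure_fast_defect cantor_interval_thirds) simp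
  \<comment> \<open>The root interval \<open>{2/3..1}\<close> has length 1/3, which gives 1/63 at
    depth 0.\<close>
  also have "(1/3)\<^sup>2 / 7 * (1/36) ^ n = ?e" by (simp add: power2_eq_square)
  also have "ennreal (measure lborel ?R) + ennreal ?e = ennreal (measure lborel ?R + ?e)"
    by (rule ennreal_plus[symmetric]) simp_all
  finally have "measure lborel ?D \<le> measure lborel ?R + ?e"
    unfolding m[OF D] by (subst (asm) ennreal_le_iff) simp_all
  \<comment> \<open>Compact sets are Borel, so completing the measure does not change their
    value.\<close>
  moreover have "measure lebesgue A = measure lborel A" if "compact A" for A :: "real set"
    using borel_compact[OF that] by (intro measure_completion) simp
  ultimately show ?thesis using lower D R by simp
qed

end
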